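(* Let $G$ and $N$ be finite groups having the same order, and let $M$ be a characteristic subgroup of $N$. Let $\mathfrak{f}\in\mathrm{Hom}(G,\mathrm{Aut}(N))$ and $\mathfrak{g}\in Z^1_{\mathfrak{f}}(G,N)$. Let $\overline{\mathfrak{f}}:G\to\mathrm{Aut}(N)\to\mathrm{Aut}(N/M)$ be the homomorphism and $\overline{\mathfrak{g}}:G\to N\to N/M$ the map obtained from $\mathfrak{f}$ and $\mathfrak{g}$ by composing with the natural homomorphisms, and define $\ker(\overline{\mathfrak{g}})=\{\sigma\in G:\overline{\mathfrak{g}}(\sigma)=1_{N/M}\}$. Then: (a) The set $\ker(\overline{\mathfrak{g}})$ is a subgroup of $G$. (b) The map $\overline{\mathfrak{g}}$ induces an injection $G/\ker(\overline{\mathfrak{g}})\to N/M$. (c) The map $\overline{\mathfrak{g}}$ restricts to a homomorphism $\ker(\overline{\mathfrak{f}})\to N/M$. (d) If $N/M$ is abelian, then for any $\sigma\in\ker(\overline{\mathfrak{f}})\cap Z(G)$, the element $\overline{\mathfrak{g}}(\sigma)$ is fixed by all automorphisms in $\overline{\mathfrak{f}}(G)$.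
   Context: A subgroup $M$ of $N$ is characteristic if $\varphi(M)=M$ for all $\varphi\in\mathrm{Aut}(N)$; it is then normal and there is a natural homomorphism $\mathrm{Aut}(N)\to\mathrm{Aut}(N/M)$. For $\mathfrak{f}\in\mathrm{Hom}(G,\mathrm{Aut}(N))$, $Z^1_{\mathfrak{f}}(G,N)$ is the set of crossed homomorphisms with respect to $\mathfrak{f}$, i.e. maps $\mathfrak{g}:G\to N$ with $\mathfrak{g}(\sigma_1\sigma_2)=\mathfrak{g}(\sigma_1)\cdot\mathfrak{f}(\sigma_1)(\mathfrak{g}(\sigma_2))$ for all $\sigma_1,\sigma_2\in G$. $Z(G)$ is the center of $G$. In (b), $G/\ker(\overline{\mathfrak{g}})$ denotes the set of left cosets $\sigma\ker(\overline{\mathfrak{g}})$. *)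

theory Defs
  imports "HOL-Algebra.Bij" "HOL-Algebra.Left_Coset"
begin

definition center :: "('a, 'm) monoid_scheme \<Rightarrow> 'a set" where
  "center G = {z \<in> carrier G. \<forall>x\<in>carrier G. z \<otimes>\<^bsub>G\<^esub> x = x \<otimes>\<^bsub>G\<^esub> z}"

definition characteristic_subgroup :: "'a set \<Rightarrow> ('a, 'm) monoid_scheme \<Rightarrow> bool" where
  "characteristic_subgroup M N \<longleftrightarrow> subgroup M N \<and> (\<forall>\<phi>\<in>carrier (AutoGroup N). \<phi> ` M = M)"

text \<open>As for \<^const>\<open>hom\<close>, the values of a crossed homomorphism outside the carrier are
  irrelevant.\<close>

definition crossed_homs ::
    "('a, 'm) monoid_scheme \<Rightarrow> ('b, 'n) monoid_scheme \<Rightarrow> ('a \<Rightarrow> 'b \<Rightarrow> 'b) \<Rightarrow> ('a \<Rightarrow> 'b) set" where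
  "crossed_homs G N f = {g. g \<in> carrier G \<rightarrow> carrier N \<and>
     (\<forall>\<sigma>\<in>carrier G. \<forall>\<tau>\<in>carrier G. g (\<sigma> \<otimes>\<^bsub>G\<^esub> \<tau>) = g \<sigma> \<otimes>\<^bsub>N\<^esub> f \<sigma> (g \<tau>))}"

text \<open>The library's quotient \<^term>\<open>N Mod M\<close> consists of right cosets; for normal \<^term>\<open>M\<close>
  these are the left cosets.\<close>

definition quot_proj :: "('a, 'm) monoid_scheme \<Rightarrow> 'a set \<Rightarrow> 'a \<Rightarrow> 'a set" where
  "quot_proj N M x = M #>\<^bsub>N\<^esub> x"

text \<open>The automorphism of \<^term>\<open>N Mod M\<close> induced by an automorphism \<^term>\<open>\<phi>\<close> of \<^term>\<open>N\<close>
  sends a coset to its image under \<^term>\<open>\<phi>\<close>, so the coset of \<^term>\<open>x\<close> goes to the coset of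
  \<^term>\<open>\<phi> x\<close> (lemma \<open>quot_aut_proj\<close>). It is restricted to the cosets because automorphisms
  in \<^const>\<open>AutoGroup\<close> are extensional functions.\<close>

definition quot_aut :: "('a, 'm) monoid_scheme \<Rightarrow> 'a set \<Rightarrow> ('a \<Rightarrow> 'a) \<Rightarrow> 'a set \<Rightarrow> 'a set" where
  "quot_aut N M \<phi> = (\<lambda>X\<in>carrier (N Mod M). \<phi> ` X)"

lemma carrier_AutoGroup: "carrier (AutoGroup N) = auto N"
  by (simp add: AutoGroup_def)

lemma autoD:
  assumes "\<phi> \<in> auto N"
  shows "bij_betw \<phi> (carrier N) (carrier N)" "\<phi> \<in> hom N N"
  using assms by (auto simp: auto_def Bij_def)

lemma conj_in_auto:
  assumes "group N" "a \<in> carrier N"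
  shows "(\<lambda>x\<in>carrier N. a \<otimes>\<^bsub>N\<^esub> x \<otimes>\<^bsub>N\<^esub> inv\<^bsub>N\<^esub> a) \<in> auto N"
proof -
  interpret group N by fact
  have canc: "a \<otimes>\<^bsub>N\<^esub> (inv\<^bsub>N\<^esub> a \<otimes>\<^bsub>N\<^esub> y) = y" "inv\<^bsub>N\<^esub> a \<otimes>\<^bsub>N\<^esub> (a \<otimes>\<^bsub>N\<^esub> y) = y" if "y \<in> carrier N" for y
    using assms(2) that by (simp_all add: m_assoc[symmetric])
  have "bij_betw (\<lambda>x. a \<otimes>\<^bsub>N\<^esub> x \<otimes>\<^bsub>N\<^esub> inv\<^bsub>N\<^esub> a) (carrier N) (carrier N)"
    by (rule bij_betw_byWitness[where f' = "\<lambda>x. inv\<^bsub>N\<^esub> a \<otimes>\<^bsub>N\<^esub> x \<otimes>\<^bsub>N\<^esub> a"])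
      (use assms(2) in \<open>auto simp: m_assoc canc\<close>)
  moreover have "(\<lambda>x\<in>carrier N. a \<otimes>\<^bsub>N\<^esub> x \<otimes>\<^bsub>N\<^esub> inv\<^bsub>N\<^esub> a) \<in> hom N N"
    using assms(2) by (auto simp: hom_def m_assoc canc)
  ultimately show ?thesis
    by (auto simp: auto_def Bij_def cong: bij_betw_cong)
qed

lemma characteristic_subgroup_normal:
  assumes "group N" "characteristic_subgroup M N"
  shows "M \<lhd> N"
proof -
  interpret group N by fact
  have M: "subgroup M N" using assms(2) by (simp add: characteristic_subgroup_def)
  have "a \<otimes>\<^bsub>N\<^esub> h \<otimes>\<^bsub>N\<^esub> inv\<^bsub>N\<^esub> a \<in> M" if "a \<in> carrier N" "h \<in> M" for a h
  proof -
    let ?c = "\<lambda>x\<in>carrier N. a \<otimes>\<^bsub>N\<^esub> x \<otimes>\<^bsub>N\<^esub> inv\<^bsub>N\<^esub> a"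
    have "?c ` M = M"
      using assms(2) conj_in_auto[OF assms(1) that(1)]
      unfolding characteristic_subgroup_def carrier_AutoGroup by blast
    then have "?c h \<in> M" by (rule equalityD1[THEN subsetD]) (rule imageI[OF that(2)])
    then show ?thesis using subgroup.mem_carrier[OF M that(2)] by simp
  qed
  with M show ?thesis by (simp add: normal_inv_iff)
qed

lemma quot_proj_hom:
  assumes "group N" "characteristic_subgroup M N"
  shows "quot_proj N M \<in> hom N (N Mod M)"
proof -
  have "(\<lambda>x. M #>\<^bsub>N\<^esub> x) \<in> hom N (N Mod M)"
    by (rule normal.r_coset_hom_Mod[OF characteristic_subgroup_normal[OF assms]])
  then show ?thesis by (simp add: quot_proj_def[abs_def])
qed

lemma carrier_Mod_proj: "carrier (N Mod M) = quot_proj N M ` carrier N"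
  by (auto simp: FactGroup_def RCOSETS_def quot_proj_def)

lemma quot_aut_proj:
  assumes "group N" "characteristic_subgroup M N" "\<phi> \<in> auto N" "x \<in> carrier N"
  shows "quot_aut N M \<phi> (quot_proj N M x) = quot_proj N M (\<phi> x)"
proof -
  have M: "M \<subseteq> carrier N" and im: "\<phi> ` M = M"
    using assms(2,3) subgroup.subset
    by (auto simp: characteristic_subgroup_def carrier_AutoGroup)
  have "\<phi> ` (M #>\<^bsub>N\<^esub> x) = (\<phi> ` M) #>\<^bsub>N\<^esub> \<phi> x"
    using M assms(4) autoD(2)[OF assms(3)] by (auto simp: r_coset_def hom_def image_UN subset_eq)
  then show ?thesis
    using assms(4) im by (simp add: quot_aut_def carrier_Mod_proj) (simp add: quot_proj_def)
qed

lemma quot_aut_in_auto: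
  assumes N: "group N" and M: "characteristic_subgroup M N" and \<phi>: "\<phi> \<in> auto N"
  shows "quot_aut N M \<phi> \<in> auto (N Mod M)"
proof -
  interpret group N by fact
  let ?p = "quot_proj N M" and ?q = "quot_aut N M \<phi>"
  note eq = quot_aut_proj[OF N M \<phi>]
  have bij: "bij_betw \<phi> (carrier N) (carrier N)" and h: "\<phi> \<in> hom N N" using autoD[OF \<phi>] by auto
  have ph: "?p (x \<otimes>\<^bsub>N\<^esub> y) = ?p x \<otimes>\<^bsub>N Mod M\<^esub> ?p y" if "x \<in> carrier N" "y \<in> carrier N" for x y
    using quot_proj_hom[OF N M] that by (simp add: hom_def)
  have cl: "\<phi> x \<in> carrier N" if "x \<in> carrier N" for x
    using h that by (auto simp: hom_def)
  have hm: "\<phi> (x \<otimes>\<^bsub>N\<^esub> y) = \<phi> x \<otimes>\<^bsub>N\<^esub> \<phi> y" if "x \<in> carrier N" "y \<in> carrier N" for x y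
    using h that by (simp add: hom_def)
  have "?q \<in> hom (N Mod M) (N Mod M)"
  proof (rule homI)
    fix X assume "X \<in> carrier (N Mod M)"
    then show "?q X \<in> carrier (N Mod M)" by (auto simp: carrier_Mod_proj eq cl)
  next
    fix X Y assume "X \<in> carrier (N Mod M)" "Y \<in> carrier (N Mod M)"
    then obtain x y where "x \<in> carrier N" "y \<in> carrier N" "X = ?p x" "Y = ?p y"
      by (auto simp: carrier_Mod_proj)
    then show "?q (X \<otimes>\<^bsub>N Mod M\<^esub> Y) = ?q X \<otimes>\<^bsub>N Mod M\<^esub> ?q Y"
      by (simp add: ph[symmetric] eq hm cl del: mult_FactGroup)
  qed
  moreover have "bij_betw ?q (carrier (N Mod M)) (carrier (N Mod M))"
  proof (rule bij_betwI')
    fix X Y assume XY: "X \<in> carrier (N Mod M)" "Y \<in> carrier (N Mod M)"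
    then have sub: "X \<subseteq> carrier N" "Y \<subseteq> carrier N"
      using M
      by (auto simp: FactGroup_def characteristic_subgroup_def
          intro: subgroup.rcosets_carrier[OF _ N, THEN subsetD])
    show "(?q X = ?q Y) = (X = Y)"
      using XY inj_on_image_eq_iff[OF bij_betw_imp_inj_on[OF bij] sub] by (simp add: quot_aut_def)
  next
    fix X assume "X \<in> carrier (N Mod M)"
    then show "?q X \<in> carrier (N Mod M)" by (auto simp: carrier_Mod_proj eq cl)
  next
    fix Y assume "Y \<in> carrier (N Mod M)"
    then obtain y where y: "y \<in> carrier N" "Y = ?p y" by (auto simp: carrier_Mod_proj)
    then obtain x where "x \<in> carrier N" "y = \<phi> x" using bij by (auto simp: bij_betw_def)
    then show "\<exists>X\<in>carrier (N Mod M). Y = ?q X" using y by (auto simp: carrier_Mod_proj eq)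
  qed
  ultimately show ?thesis by (simp add: auto_def Bij_def quot_aut_def)
qed

lemma mult_AutoGroup:
  "\<phi> \<in> auto N \<Longrightarrow> \<psi> \<in> auto N \<Longrightarrow> \<phi> \<otimes>\<^bsub>AutoGroup N\<^esub> \<psi> = compose (carrier N) \<phi> \<psi>"
  by (simp add: AutoGroup_def BijGroup_def auto_def)

lemma quot_aut_hom:
  assumes N: "group N" and M: "characteristic_subgroup M N"
  shows "quot_aut N M \<in> hom (AutoGroup N) (AutoGroup (N Mod M))"
proof (rule homI)
  fix \<phi> assume "\<phi> \<in> carrier (AutoGroup N)"
  then show "quot_aut N M \<phi> \<in> carrier (AutoGroup (N Mod M))"
    by (simp add: carrier_AutoGroup quot_aut_in_auto[OF N M])
next
  fix \<phi> \<psi> assume "\<phi> \<in> carrier (AutoGroup N)" "\<psi> \<in> carrier (AutoGroup N)"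
  then have a: "\<phi> \<in> auto N" "\<psi> \<in> auto N" by (simp_all add: carrier_AutoGroup)
  have ab: "compose (carrier N) \<phi> \<psi> \<in> auto N"
    using monoid.m_closed[OF group.is_monoid[OF group.AutoGroup[OF N]], of \<phi> \<psi>] a
    by (simp add: carrier_AutoGroup mult_AutoGroup)
  have cl: "\<psi> x \<in> carrier N" if "x \<in> carrier N" for x
    using autoD(2)[OF a(2)] that by (auto simp: hom_def)
  have "quot_aut N M (compose (carrier N) \<phi> \<psi>)
      = compose (carrier (N Mod M)) (quot_aut N M \<phi>) (quot_aut N M \<psi>)"
  proof (rule extensionalityI[of _ "carrier (N Mod M)"])
    fix X assume "X \<in> carrier (N Mod M)"
    then obtain x where "x \<in> carrier N" "X = quot_proj N M x" by (auto simp: carrier_Mod_proj)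
    then show "quot_aut N M (compose (carrier N) \<phi> \<psi>) X
        = compose (carrier (N Mod M)) (quot_aut N M \<phi>) (quot_aut N M \<psi>) X"
      using quot_aut_proj[OF N M] a ab cl by (simp add: compose_eq carrier_Mod_proj)
  qed (simp_all add: quot_aut_def compose_def)
  then show "quot_aut N M (\<phi> \<otimes>\<^bsub>AutoGroup N\<^esub> \<psi>)
      = quot_aut N M \<phi> \<otimes>\<^bsub>AutoGroup (N Mod M)\<^esub> quot_aut N M \<psi>"
    by (simp add: mult_AutoGroup a quot_aut_in_auto[OF N M])
qed

end

theory Submission
  imports Defs
begin

text \<open>
  Everything happens in the quotient.  Since \<open>M\<close> is characteristic, the automorphisms in the image
  of \<open>f\<close> descend to \<open>N Mod M\<close>, and projecting the cocycle identity shows that \<open>gbar\<close> is again a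
  crossed homomorphism, now with respect to the action \<open>fbar\<close> (\<open>crossed_hom_quotient\<close>).
  It therefore suffices to prove the four claims for an arbitrary crossed homomorphism \<open>g\<close> from
  \<open>G\<close> to a group \<open>Q\<close> on which \<open>G\<close> acts through \<open>f\<close>, and each is read off from
  \<open>g (\<sigma> \<tau>) = g \<sigma> \<cdot> f \<sigma> (g \<tau>)\<close>.

  The kernel is a subgroup because every \<open>f \<sigma>\<close> fixes the identity.  Writing
  \<open>\<tau> = \<sigma> (\<sigma>\<inverse> \<tau>)\<close> gives \<open>g \<tau> = g \<sigma> \<cdot> f \<sigma> (g (\<sigma>\<inverse> \<tau>))\<close>, so by injectivity of \<open>f \<sigma>\<close> the values
  at \<open>\<sigma>\<close> and \<open>\<tau>\<close> agree exactly when \<open>\<sigma>\<inverse> \<tau>\<close> is in the kernel, that is, when \<open>\<sigma>\<close> and \<open>\<tau>\<close> span the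
  same left coset: the fibres of \<open>g\<close> are the left cosets (\<open>fibres_are_left_cosets\<close>).  Where
  \<open>f \<sigma>\<close> is the identity, the cocycle identity is the homomorphism identity.  Finally, if moreover
  \<open>\<sigma>\<close> is central, expanding \<open>g (\<sigma> \<tau>) = g (\<tau> \<sigma>)\<close> both ways gives
  \<open>g \<sigma> \<cdot> g \<tau> = g \<tau> \<cdot> f \<tau> (g \<sigma>)\<close>, and if \<open>Q\<close> is abelian then \<open>g \<tau>\<close> cancels
  (\<open>central_value_fixed\<close>).
\<close>

locale crossed_hom = G: group G + Q: group Q
  for G :: "('a, 'm) monoid_scheme" (structure) and Q :: "('b, 'n) monoid_scheme" (structure) +
  fixes f :: "'a \<Rightarrow> 'b \<Rightarrow> 'b" and g :: "'a \<Rightarrow> 'b"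
  assumes action: "f \<in> hom G (AutoGroup Q)"
    and crossed: "g \<in> crossed_homs G Q f"
begin

lemma action_auto: "\<sigma> \<in> carrier G \<Longrightarrow> f \<sigma> \<in> auto Q"
  using action by (auto simp: hom_def carrier_AutoGroup)

lemma action_group_hom: "\<sigma> \<in> carrier G \<Longrightarrow> group_hom Q Q (f \<sigma>)"
  using autoD(2)[OF action_auto]
  by (simp add: group_hom_def group_hom_axioms_def Q.is_group)

lemma action_closed: "\<sigma> \<in> carrier G \<Longrightarrow> x \<in> carrier Q \<Longrightarrow> f \<sigma> x \<in> carrier Q"
  by (rule group_hom.hom_closed[OF action_group_hom])

lemma action_one: "\<sigma> \<in> carrier G \<Longrightarrow> f \<sigma> \<one>\<^bsub>Q\<^esub> = \<one>\<^bsub>Q\<^esub>"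
  by (rule group_hom.hom_one[OF action_group_hom])

lemma action_eq_one_iff:
  assumes "\<sigma> \<in> carrier G" "x \<in> carrier Q"
  shows "f \<sigma> x = \<one>\<^bsub>Q\<^esub> \<longleftrightarrow> x = \<one>\<^bsub>Q\<^esub>"
  using inj_on_eq_iff[OF bij_betw_imp_inj_on[OF autoD(1)[OF action_auto]], of \<sigma> x "\<one>\<^bsub>Q\<^esub>"]
    assms action_one by simp

lemma action_kernel_trivial:
  assumes "\<sigma> \<in> kernel G (AutoGroup Q) f" "x \<in> carrier Q"
  shows "f \<sigma> x = x"
  using assms by (simp add: kernel_def AutoGroup_def BijGroup_def)

lemma value_closed: "\<sigma> \<in> carrier G \<Longrightarrow> g \<sigma> \<in> carrier Q"
  using crossed by (auto simp: crossed_homs_def)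

lemma cocycle:
  "\<sigma> \<in> carrier G \<Longrightarrow> \<tau> \<in> carrier G \<Longrightarrow> g (\<sigma> \<otimes> \<tau>) = g \<sigma> \<otimes>\<^bsub>Q\<^esub> f \<sigma> (g \<tau>)"
  using crossed by (simp add: crossed_homs_def)

lemma value_one: "g \<one> = \<one>\<^bsub>Q\<^esub>"
proof -
  have "g \<one> \<otimes>\<^bsub>Q\<^esub> f \<one> (g \<one>) = g \<one>"
    using cocycle[of \<one> \<one>] by simp
  then have "f \<one> (g \<one>) = \<one>\<^bsub>Q\<^esub>"
    by (simp add: action_closed value_closed)
  then show ?thesis
    by (simp add: action_eq_one_iff value_closed)
qed

text \<open>
  Although \<open>g\<close> is not a homomorphism, the kernel is closed under products and inverses: when
  \<open>g \<tau>\<close> is trivial, so is the twisted factor \<open>f \<sigma> (g \<tau>)\<close>, and \<open>g (\<sigma> \<tau>)\<close> collapses to \<open>g \<sigma>\<close>.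
\<close>

lemma kernel_subgroup: "subgroup (kernel G Q g) G"
proof (rule G.subgroupI)
  show "kernel G Q g \<subseteq> carrier G" by (auto simp: kernel_def)
  show "kernel G Q g \<noteq> {}" using value_one by (auto simp: kernel_def)
next
  fix \<sigma> assume "\<sigma> \<in> kernel G Q g"
  then have \<sigma>: "\<sigma> \<in> carrier G" "g \<sigma> = \<one>\<^bsub>Q\<^esub>" by (auto simp: kernel_def)
  have "\<one>\<^bsub>Q\<^esub> = g (inv \<sigma>) \<otimes>\<^bsub>Q\<^esub> f (inv \<sigma>) (g \<sigma>)"
    using cocycle[of "inv \<sigma>" \<sigma>] \<sigma> by (simp add: value_one)
  then show "inv \<sigma> \<in> kernel G Q g"
    using \<sigma> by (simp add: kernel_def action_one value_closed)
next
  fix \<sigma> \<tau> assume "\<sigma> \<in> kernel G Q g" "\<tau> \<in> kernel G Q g"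
  then show "\<sigma> \<otimes> \<tau> \<in> kernel G Q g"
    by (simp add: kernel_def cocycle action_one)
qed

text \<open>
  The quotient of the values at \<open>\<sigma>\<close> and \<open>\<tau>\<close> is \<open>f \<sigma> (g (\<sigma>\<inverse> \<tau>))\<close>: the twist by \<open>f \<sigma>\<close> changes
  this element, but not whether it is trivial.
\<close>

lemma value_eq_iff:
  assumes \<sigma>: "\<sigma> \<in> carrier G" and \<tau>: "\<tau> \<in> carrier G"
  shows "g \<sigma> = g \<tau> \<longleftrightarrow> inv \<sigma> \<otimes> \<tau> \<in> kernel G Q g"
proof -
  have "g \<tau> = g \<sigma> \<otimes>\<^bsub>Q\<^esub> f \<sigma> (g (inv \<sigma> \<otimes> \<tau>))"
    using cocycle[of \<sigma> "inv \<sigma> \<otimes> \<tau>"] \<sigma> \<tau> by (simp add: G.m_assoc[symmetric])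
  then have "g \<sigma> = g \<tau> \<longleftrightarrow> f \<sigma> (g (inv \<sigma> \<otimes> \<tau>)) = \<one>\<^bsub>Q\<^esub>"
    using \<sigma> \<tau> by (simp add: action_closed value_closed)
  then show ?thesis
    using \<sigma> \<tau> by (simp add: action_eq_one_iff value_closed kernel_def)
qed

lemma fibres_are_left_cosets:
  assumes \<sigma>: "\<sigma> \<in> carrier G"
  shows "\<sigma> <# kernel G Q g = {\<tau> \<in> carrier G. g \<tau> = g \<sigma>}"
proof (intro equalityI subsetI)
  fix \<tau> assume "\<tau> \<in> \<sigma> <# kernel G Q g"
  then obtain \<kappa> where "\<kappa> \<in> carrier G" "g \<kappa> = \<one>\<^bsub>Q\<^esub>" "\<tau> = \<sigma> \<otimes> \<kappa>"
    by (auto simp: l_coset_def kernel_def)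
  then show "\<tau> \<in> {\<tau> \<in> carrier G. g \<tau> = g \<sigma>}"
    using \<sigma> by (simp add: cocycle action_one value_closed)
next
  fix \<tau> assume "\<tau> \<in> {\<tau> \<in> carrier G. g \<tau> = g \<sigma>}"
  then have \<tau>: "\<tau> \<in> carrier G" and "inv \<sigma> \<otimes> \<tau> \<in> kernel G Q g"
    using \<sigma> value_eq_iff[of \<sigma> \<tau>] by auto
  moreover have "\<tau> = \<sigma> \<otimes> (inv \<sigma> \<otimes> \<tau>)"
    using \<sigma> \<tau> by (simp add: G.m_assoc[symmetric])
  ultimately show "\<tau> \<in> \<sigma> <# kernel G Q g"
    unfolding l_coset_def by blast
qed

lemma induced_injection_on_left_cosets:
  obtains h where "h \<in> lcosets (kernel G Q g) \<rightarrow> carrier Q"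
    and "\<And>\<sigma>. \<sigma> \<in> carrier G \<Longrightarrow> h (\<sigma> <# kernel G Q g) = g \<sigma>"
    and "inj_on h (lcosets (kernel G Q g))"
proof
  \<comment> \<open>\<open>g\<close> is constant on a left coset, so the image of the coset is a singleton.\<close>
  let ?h = "\<lambda>C. the_elem (g ` C)"
  have val: "?h (\<sigma> <# kernel G Q g) = g \<sigma>" if "\<sigma> \<in> carrier G" for \<sigma>
  proof -
    have "g ` (\<sigma> <# kernel G Q g) = {g \<sigma>}"
      using that by (auto simp: fibres_are_left_cosets)
    then show ?thesis by simp
  qed
  then show "\<And>\<sigma>. \<sigma> \<in> carrier G \<Longrightarrow> ?h (\<sigma> <# kernel G Q g) = g \<sigma>" .
  show "?h \<in> lcosets (kernel G Q g) \<rightarrow> carrier Q"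
    by (auto simp: LCOSETS_def val value_closed)
  show "inj_on ?h (lcosets (kernel G Q g))"
  proof (rule inj_onI)
    fix C D
    assume "C \<in> lcosets (kernel G Q g)" "D \<in> lcosets (kernel G Q g)" and eq: "?h C = ?h D"
    then obtain \<sigma> \<tau> where \<sigma>: "\<sigma> \<in> carrier G" "C = \<sigma> <# kernel G Q g"
      and \<tau>: "\<tau> \<in> carrier G" "D = \<tau> <# kernel G Q g"
      by (auto simp: LCOSETS_def)
    have "g \<sigma> = g \<tau>" using eq \<sigma> \<tau> by (simp only: val)
    then show "C = D" using \<sigma> \<tau> by (simp add: fibres_are_left_cosets)
  qed
qed

lemma hom_on_action_kernel: "g \<in> hom (G\<lparr>carrier := kernel G (AutoGroup Q) f\<rparr>) Q"
proof (rule homI)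
  fix \<sigma> \<tau>
  assume "\<sigma> \<in> carrier (G\<lparr>carrier := kernel G (AutoGroup Q) f\<rparr>)"
    and "\<tau> \<in> carrier (G\<lparr>carrier := kernel G (AutoGroup Q) f\<rparr>)"
  then have "\<sigma> \<in> kernel G (AutoGroup Q) f" "\<sigma> \<in> carrier G" "\<tau> \<in> carrier G"
    by (auto simp: kernel_def)
  then show "g (\<sigma> \<otimes>\<^bsub>G\<lparr>carrier := kernel G (AutoGroup Q) f\<rparr>\<^esub> \<tau>) = g \<sigma> \<otimes>\<^bsub>Q\<^esub> g \<tau>"
    by (simp add: cocycle action_kernel_trivial value_closed)
qed (auto simp: kernel_def value_closed)

text \<open>
  The product \<open>\<sigma> \<tau> = \<tau> \<sigma>\<close> is expanded in both orders; the action of \<open>\<sigma>\<close> is trivial, so only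
  the twist of \<open>g \<sigma>\<close> by \<open>\<tau>\<close> survives.
\<close>

lemma central_value_fixed:
  assumes "comm_group Q"
    and \<sigma>_ker: "\<sigma> \<in> kernel G (AutoGroup Q) f" and \<sigma>_central: "\<sigma> \<in> center G"
    and \<tau>: "\<tau> \<in> carrier G"
  shows "f \<tau> (g \<sigma>) = g \<sigma>"
proof -
  interpret Q: comm_group Q by fact
  have \<sigma>: "\<sigma> \<in> carrier G" and comm: "\<sigma> \<otimes> \<tau> = \<tau> \<otimes> \<sigma>"
    using \<sigma>_central \<tau> by (auto simp: center_def)
  have "g \<tau> \<otimes>\<^bsub>Q\<^esub> f \<tau> (g \<sigma>) = g (\<sigma> \<otimes> \<tau>)"
    using \<sigma> \<tau> by (simp add: comm cocycle)
  also have "\<dots> = g \<sigma> \<otimes>\<^bsub>Q\<^esub> g \<tau>"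
    using \<sigma> \<tau> by (simp add: cocycle action_kernel_trivial[OF \<sigma>_ker] value_closed)
  also have "\<dots> = g \<tau> \<otimes>\<^bsub>Q\<^esub> g \<sigma>"
    using \<sigma> \<tau> by (simp add: Q.m_comm value_closed)
  finally show ?thesis
    using \<sigma> \<tau> by (simp add: action_closed value_closed)
qed

end

text \<open>
  The projection turns the action of \<open>f \<sigma>\<close> on \<open>N\<close> into the action of \<open>quot_aut N M (f \<sigma>)\<close> on
  \<open>N Mod M\<close>, so it carries the cocycle identity of \<open>g\<close> to that of the composite.
\<close>

lemma crossed_hom_quotient:
  assumes G: "group G" and N: "group N" and M: "characteristic_subgroup M N"
    and f: "f \<in> hom G (AutoGroup N)" and g: "g \<in> crossed_homs G N f"
  shows "crossed_hom G (N Mod M) (quot_aut N M \<circ> f) (quot_proj N M \<circ> g)"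
proof -
  interpret N: crossed_hom G N f g
    using G N f g by (simp add: crossed_hom_def crossed_hom_axioms_def)
  have p: "quot_proj N M \<in> hom N (N Mod M)"
    by (rule quot_proj_hom[OF N M])
  have "quot_aut N M \<circ> f \<in> hom G (AutoGroup (N Mod M))"
    using f quot_aut_hom[OF N M] by (rule hom_compose)
  moreover have "quot_proj N M \<circ> g \<in> crossed_homs G (N Mod M) (quot_aut N M \<circ> f)"
    using hom_carrier[OF p]
    by (auto simp: crossed_homs_def N.value_closed N.cocycle N.action_closed hom_mult[OF p]
        quot_aut_proj[OF N M N.action_auto] simp del: mult_FactGroup)
  moreover have "group (N Mod M)"
    by (rule normal.factorgroup_is_group[OF characteristic_subgroup_normal[OF N M]])
  ultimately show ?thesis
    using G by (simp add: crossed_hom_def crossed_hom_axioms_def)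
qed

theorem lemma4p1:
  fixes G :: "('a, 'm) monoid_scheme"
    and N :: "('b, 'n) monoid_scheme"
    and M :: "'b set"
    and f :: "'a \<Rightarrow> 'b \<Rightarrow> 'b"
    and g :: "'a \<Rightarrow> 'b"
    and fbar :: "'a \<Rightarrow> 'b set \<Rightarrow> 'b set"
    and gbar :: "'a \<Rightarrow> 'b set"
  assumes "group G" and "finite (carrier G)"
    and "group N" and "finite (carrier N)"
    and "order G = order N"
    and "characteristic_subgroup M N"
    and "f \<in> hom G (AutoGroup N)"
    and "g \<in> crossed_homs G N f"
    and fbar: "fbar = quot_aut N M \<circ> f"
    and gbar: "gbar = quot_proj N M \<circ> g"
  shows "subgroup (kernel G (N Mod M) gbar) G \<and>
    (\<exists>h. h \<in> lcosets\<^bsub>G\<^esub> (kernel G (N Mod M) gbar) \<rightarrow> carrier (N Mod M) \<and>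
         (\<forall>\<sigma>\<in>carrier G. h (\<sigma> <#\<^bsub>G\<^esub> kernel G (N Mod M) gbar) = gbar \<sigma>) \<and>
         inj_on h (lcosets\<^bsub>G\<^esub> (kernel G (N Mod M) gbar))) \<and>
    gbar \<in> hom (G\<lparr>carrier := kernel G (AutoGroup (N Mod M)) fbar\<rparr>) (N Mod M) \<and>
    (comm_group (N Mod M) \<longrightarrow>
       (\<forall>\<sigma> \<in> kernel G (AutoGroup (N Mod M)) fbar \<inter> center G.
          \<forall>\<psi> \<in> fbar ` carrier G. \<psi> (gbar \<sigma>) = gbar \<sigma>))"
proof -
  interpret crossed_hom G "N Mod M" fbar gbar
    unfolding fbar gbar using assms by (intro crossed_hom_quotient)
  obtain h where
    "h \<in> lcosets\<^bsub>G\<^esub> (kernel G (N Mod M) gbar) \<rightarrow> carrier (N Mod M)"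
    "\<And>\<sigma>. \<sigma> \<in> carrier G \<Longrightarrow> h (\<sigma> <#\<^bsub>G\<^esub> kernel G (N Mod M) gbar) = gbar \<sigma>"
    "inj_on h (lcosets\<^bsub>G\<^esub> (kernel G (N Mod M) gbar))"
    by (rule induced_injection_on_left_cosets) blast
  then show ?thesis
    using kernel_subgroup hom_on_action_kernel central_value_fixed by blast
qed

end
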